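(* Let $\mathcal{H}$ be a real Hilbert space. Let $A,B,C\colon\mathcal{H}\rightrightarrows\mathcal{H}$ be maximally $\alpha_A$-monotone, maximally $\alpha_B$-monotone, and maximally $\alpha_C$-monotone, respectively, where $\alpha_A,\alpha_B,\alpha_C\in\mathbb{R}$. Let $\theta,\sigma_A,\sigma_B,\sigma_C>0$ be such that $\theta\alpha_A+\sigma_A>0$, $\theta\alpha_B+\sigma_B>0$ and $\theta\alpha_C+\sigma_C>0$, let $\gamma>0$, and let $\lambda\in\left]0,1\right]$. Suppose $q\in\operatorname{ran}\left(\mathrm{Id}+\frac{\theta}{\sigma_A+\sigma_B+\sigma_C}(A+B+C)\right)$. Given any $x_0,y_0\in\mathcal{H}$, consider the sequences given, for $k\in\mathbb{N}$, by $$\left\{\begin{aligned} u_k&=J_{\frac{\gamma\theta}{1+\gamma\sigma_A}A}\left(\frac{1}{1+\gamma\sigma_A}x_k+\frac{\gamma\sigma_A}{1+\gamma\sigma_A}q\right)\\ v_k&=J_{\frac{\gamma\theta}{1+\gamma\sigma_B}B}\left(\frac{1}{1+\gamma\sigma_B}(u_k+y_k)-\frac{1-\gamma\sigma_B}{1+\gamma\sigma_B}q\right)\\ w_k&=J_{\frac{\gamma\theta}{1+\gamma\sigma_C}C}\left(\frac{1}{1+\gamma\sigma_C}(u_k-x_k+v_k-y_k)+q\right)\\ x_{k+1}&=x_k+\lambda(w_k-u_k)\\ y_{k+1}&=y_k+\lambda(w_k-v_k).\end{aligned}\right.$$ Then $u_k\to J_{\frac{\theta}{\sigma_A+\sigma_B+\sigma_C}(A+B+C)}(q)$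 in norm as $k\to+\infty$. Further, if $\lambda\neq1$, then $(x_k)$ converges weakly to some $x\in\mathcal{H}$ with $$J_{\frac{\gamma\theta}{1+\gamma\sigma_A}A}\left(\frac{1}{1+\gamma\sigma_A}x+\frac{\gamma\sigma_A}{1+\gamma\sigma_A}q\right)=J_{\frac{\theta}{\sigma_A+\sigma_B+\sigma_C}(A+B+C)}(q).$$
   Context: For $\alpha\in\mathbb{R}$, a set-valued operator $A\colon\mathcal{H}\rightrightarrows\mathcal{H}$ is $\alpha$-monotone if $\langle x-y,u-v\rangle\ge\alpha\|x-y\|^2$ for all $(x,u),(y,v)$ in its graph, and maximally $\alpha$-monotone if moreover no $\alpha$-monotone operator has a graph properly containing that of $A$. $\operatorname{ran}A=\{u:\exists x,\ u\in A(x)\}$. The resolvent of $A$ with parameter $\gamma>0$ is $J_{\gamma A}:=(\mathrm{Id}+\gamma A)^{-1}$ (a singleton $\{u\}$ is identified with $u$). Sums of set-valued operators are pointwise Minkowski sums. *)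

theory Defs
  imports "HOL-Analysis.Analysis" "HOL-Library.Set_Algebras"
begin

text \<open>
  A set-valued operator on \<open>'a\<close> is a function \<open>'a \<Rightarrow> 'a set\<close>.  On sets, \<open>+\<close> is the
  Minkowski sum, so \<open>\<lambda>x. A x + B x\<close> is the sum of the operators \<open>A\<close> and \<open>B\<close>.
\<close>

definition op_graph :: "('a \<Rightarrow> 'b set) \<Rightarrow> ('a \<times> 'b) set" where
  "op_graph A = {(x, u). u \<in> A x}"

definition op_range :: "('a \<Rightarrow> 'b set) \<Rightarrow> 'b set" where
  "op_range A = {u. \<exists>x. u \<in> A x}"

definition op_inverse :: "('a \<Rightarrow> 'b set) \<Rightarrow> 'b \<Rightarrow> 'a set" where
  "op_inverse A u = {x. u \<in> A x}"

definition alpha_monotone :: "real \<Rightarrow> ('a::real_inner \<Rightarrow> 'a set) \<Rightarrow> bool" where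
  "alpha_monotone \<alpha> A \<longleftrightarrow>
     (\<forall>(x, u) \<in> op_graph A. \<forall>(y, v) \<in> op_graph A. inner (x - y) (u - v) \<ge> \<alpha> * (norm (x - y))\<^sup>2)"

definition maximally_alpha_monotone :: "real \<Rightarrow> ('a::real_inner \<Rightarrow> 'a set) \<Rightarrow> bool" where
  "maximally_alpha_monotone \<alpha> A \<longleftrightarrow>
     alpha_monotone \<alpha> A \<and> \<not> (\<exists>A'. alpha_monotone \<alpha> A' \<and> op_graph A \<subset> op_graph A')"

definition id_plus :: "real \<Rightarrow> ('a::real_vector \<Rightarrow> 'a set) \<Rightarrow> 'a \<Rightarrow> 'a set" where
  "id_plus \<gamma> A = (\<lambda>x. {x} + (\<lambda>u. \<gamma> *\<^sub>R u) ` A x)"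

text \<open>
  The resolvent is set-valued.  Its value at a point is identified with an element of the
  space by \<^const>\<open>the_elem\<close>, which is meaningful only when that value is a singleton.
\<close>

definition resolvent :: "real \<Rightarrow> ('a::real_vector \<Rightarrow> 'a set) \<Rightarrow> 'a \<Rightarrow> 'a set" where
  "resolvent \<gamma> A = op_inverse (id_plus \<gamma> A)"

definition weakly_convergent_to :: "(nat \<Rightarrow> 'a::real_inner) \<Rightarrow> 'a \<Rightarrow> bool" where
  "weakly_convergent_to x l \<longleftrightarrow> (\<forall>z. (\<lambda>k. inner (x k) z) \<longlonglongrightarrow> inner l z)"

end

theory Submission imports Defs begin

text \<open>
  After replacing \<open>y\<^sub>k\<close> by \<open>y\<^sub>k - q\<close>, the iteration is Ryu's three-operator splitting for the
  operators \<open>\<theta> A + \<sigma>\<^sub>A (Id - q)\<close>, \<open>\<theta> B + \<sigma>\<^sub>B (Id - q)\<close>, \<open>\<theta> C + \<sigma>\<^sub>C (Id - q)\<close>, which are strongly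
  monotone and whose sum vanishes exactly at the resolvent of \<open>A + B + C\<close> at \<open>q\<close>.  An exact
  identity for one step bounds the decrease of the squared distance to a fixed point from below by
  the strong monotonicity terms, so these are summable and \<open>u\<^sub>k\<close>, \<open>v\<^sub>k\<close>, \<open>w\<^sub>k\<close> converge in norm.
  Hence the step map is nonexpansive and asymptotically regular along \<open>(x\<^sub>k, y\<^sub>k - q)\<close>, and Opial's
  theorem gives weak convergence.  Minty's theorem and Opial's theorem both follow from the
  existence of minimizers of strongly convex lower semicontinuous functions.
\<close>

subsection \<open>Minimizers of strongly convex functions\<close>

lemma norm_convex_combination:
  fixes a b :: "'a::real_inner"
  shows "(norm ((1 - s) *\<^sub>R a + s *\<^sub>R b))\<^sup>2
    = (1 - s) * (norm a)\<^sup>2 + s * (norm b)\<^sup>2 - s * (1 - s) * (norm (a - b))\<^sup>2"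
  by (simp add: power2_norm_eq_inner inner_simps inner_commute algebra_simps)

text \<open>\<open>K\<close> plays the part of the epigraph of a strongly convex, lower
  semicontinuous function, given as a set so that infinite values do not arise. Midpoints of nearly
  lowest points lie lower still, which makes minimizing sequences Cauchy.\<close>

lemma strongly_convex_epigraph_minimum:
  fixes K :: "('a::{real_normed_vector, complete_space} \<times> real) set"
  assumes "closed K" and "K \<noteq> {}" and "0 < c"
    and lower: "\<And>z t. (z, t) \<in> K \<Longrightarrow> m \<le> t"
    and conv: "\<And>z t z' t' s. \<lbrakk>(z, t) \<in> K; (z', t') \<in> K; 0 < s; s < 1\<rbrakk> \<Longrightarrow>
      ((1 - s) *\<^sub>R z + s *\<^sub>R z',
       (1 - s) * t + s * t' - c * (s * (1 - s) * (norm (z - z'))\<^sup>2)) \<in> K"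
  obtains z0 t0 where "(z0, t0) \<in> K" and "\<And>z t. (z, t) \<in> K \<Longrightarrow> t0 + c * (norm (z - z0))\<^sup>2 \<le> t"
proof -
  define I where "I = Inf (snd ` K)"
  have bdd: "bdd_below (snd ` K)"
    using lower by (auto intro!: bdd_belowI[of _ m])
  have I_le: "I \<le> t" if "(z, t) \<in> K" for z t
    unfolding I_def using that bdd by (force intro: cInf_lower)
  have "\<exists>p\<in>K. snd p < I + 1 / real (Suc n)" for n
    using cInf_lessD[of "snd ` K" "I + 1 / real (Suc n)"] \<open>K \<noteq> {}\<close> by (auto simp: I_def)
  then obtain P where PK: "\<And>n. P n \<in> K" and P: "\<And>n. snd (P n) < I + 1 / real (Suc n)"
    by metis
  define Z where "Z n = fst (P n)" for n
  define T where "T n = snd (P n)" for n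
  have ZT: "(Z n, T n) \<in> K" for n
    using PK by (simp add: Z_def T_def)
  have T: "T n < I + 1 / real (Suc n)" for n
    using P by (simp add: T_def)
  \<comment> \<open>The point given by \<open>conv\<close> over the midpoint lies
    \<open>c / 4\<close> times the squared distance below the mean of the two heights, yet not below
    \<open>I\<close>.\<close>
  have close: "c * (norm (Z i - Z j))\<^sup>2 \<le> 2 * (1 / real (Suc i) + 1 / real (Suc j))" for i j
  proof -
    have "I \<le> T i / 2 + T j / 2 - c * (norm (Z i - Z j))\<^sup>2 / 4"
      using I_le[OF conv[OF ZT[of i] ZT[of j], of "1/2"]] by simp
    then show ?thesis
      using T[of i] T[of j] by argo
  qed
  have "Cauchy Z"
  proof (rule CauchyI)
    fix e :: real assume e: "0 < e"
    \<comment> \<open>For indices from \<open>N\<close> on, the bound in \<open>close\<close> is at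
      most \<open>4 / (N + 1)\<close>.\<close>
    obtain N where N: "inverse (real (Suc N)) < c * e\<^sup>2 / 4"
      using reals_Archimedean[of "c * e\<^sup>2 / 4"] e \<open>0 < c\<close> by auto
    have "norm (Z i - Z j) < e" if "i \<ge> N" "j \<ge> N" for i j
    proof -
      have "1 / real (Suc i) \<le> 1 / real (Suc N)" "1 / real (Suc j) \<le> 1 / real (Suc N)"
        using that by (auto simp: field_simps)
      then have "c * (norm (Z i - Z j))\<^sup>2 < c * e\<^sup>2"
        using close[of i j] N by (simp add: inverse_eq_divide)
      then show ?thesis
        using \<open>0 < c\<close> e by (simp add: power2_less_imp_less)
    qed
    then show "\<exists>N. \<forall>i\<ge>N. \<forall>j\<ge>N. norm (Z i - Z j) < e" by blast
  qed
  then obtain z0 where z0: "Z \<longlonglongrightarrow> z0"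
    using Cauchy_convergent_iff convergent_def by blast
  have "T \<longlonglongrightarrow> I"
  proof (rule tendsto_sandwich)
    show "\<forall>\<^sub>F n in sequentially. I \<le> T n"
      using I_le[OF ZT] by simp
    show "\<forall>\<^sub>F n in sequentially. T n \<le> I + 1 / real (Suc n)"
      using T by (intro always_eventually allI less_imp_le)
    show "(\<lambda>n. I + 1 / real (Suc n)) \<longlonglongrightarrow> I"
      using tendsto_add[OF tendsto_const LIMSEQ_inverse_real_of_nat, of I]
      by (simp add: inverse_eq_divide)
  qed simp
  then have min: "(z0, I) \<in> K"
    using closed_sequentially[OF \<open>closed K\<close>, of "\<lambda>n. (Z n, T n)"] ZT z0 by (auto intro: tendsto_Pair)
  \<comment> \<open>Quadratic growth: compare \<open>I\<close> with the point of \<open>K\<close>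
    over the segment from \<open>z0\<close> to \<open>z\<close>, divide by \<open>s\<close> and let
    \<open>s\<close> tend to 0.\<close>
  have "I + c * (norm (z - z0))\<^sup>2 \<le> t" if zt: "(z, t) \<in> K" for z t
  proof -
    have "c * ((1 - s) * (norm (z - z0))\<^sup>2) \<le> t - I" if s: "0 < s" "s < 1" for s
    proof -
      have "s * (c * ((1 - s) * (norm (z - z0))\<^sup>2)) \<le> s * (t - I)"
        using I_le[OF conv[OF min zt s]] by (simp add: norm_minus_commute algebra_simps)
      then show ?thesis using s by simp
    qed
    then have "\<forall>\<^sub>F s in at_right 0. c * ((1 - s) * (norm (z - z0))\<^sup>2) \<le> t - I"
      unfolding eventually_at_right_field by (intro exI[of _ 1]) auto
    moreover have "((\<lambda>s. c * ((1 - s) * (norm (z - z0))\<^sup>2)) \<longlongrightarrow> c * ((1 - 0) * (norm (z - z0))\<^sup>2))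
        (at_right 0)"
      by (intro tendsto_intros)
    ultimately have "c * ((1 - 0) * (norm (z - z0))\<^sup>2) \<le> t - I"
      using tendsto_upperbound trivial_limit_at_right_real by blast
    then show ?thesis by simp
  qed
  with min show thesis by (rule that)
qed

subsection \<open>Minty's theorem\<close>

text \<open>
  The set \<open>K\<close> is the epigraph of the Fitzpatrick function of \<open>G\<close> plus half the squared norm,
  and its lowest point \<open>(x, u)\<close> satisfies \<open>(- u, - x) \<in> G\<close>.
\<close>
lemma minty_graph:
  fixes G :: "('a::{real_inner, complete_space} \<times> 'a) set"
  assumes mono: "\<And>a b a' b'. \<lbrakk>(a, b) \<in> G; (a', b') \<in> G\<rbrakk> \<Longrightarrow> 0 \<le> inner (a - a') (b - b')"
    and maximal: "\<And>a b. (\<And>a' b'. (a', b') \<in> G \<Longrightarrow> 0 \<le> inner (a - a') (b - b')) \<Longrightarrow> (a, b) \<in> G"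
  obtains x where "(x, - x) \<in> G"
proof -
  define K where "K = {(z, t). \<forall>(a, b)\<in>G. inner z (b, a) - inner a b + (norm z)\<^sup>2 / 2 \<le> t}"
  have K: "(z, t) \<in> K \<longleftrightarrow> (\<forall>a b. (a, b) \<in> G \<longrightarrow> inner z (b, a) - inner a b + (norm z)\<^sup>2 / 2 \<le> t)" for z t
    by (auto simp: K_def)
  \<comment> \<open>The Fitzpatrick function dominates the pairing. Otherwise \<open>(x, u)\<close>
    would be monotonically related to all of \<open>G\<close>, hence lie in \<open>G\<close> by
    maximality, and the inequality defining \<open>K\<close>, tested at \<open>(x, u)\<close>
    itself, would fail.\<close>
  have above: "inner x u \<le> t - (norm (x, u))\<^sup>2 / 2" if xt: "((x, u), t) \<in> K" for x u t
  proof (rule ccontr)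
    assume neg: "\<not> ?thesis"
    have "(x, u) \<in> G"
    proof (rule maximal)
      fix a b assume "(a, b) \<in> G"
      then have "inner x b + inner u a - inner a b + (norm (x, u))\<^sup>2 / 2 \<le> t"
        using xt K by fastforce
      then show "0 \<le> inner (x - a) (u - b)"
        using neg by (simp add: inner_simps inner_commute)
    qed
    then have "inner x u + inner u x - inner x u + (norm (x, u))\<^sup>2 / 2 \<le> t"
      using xt K by fastforce
    then show False using neg by (simp add: inner_commute)
  qed
  \<comment> \<open>By monotonicity, the Fitzpatrick function does not exceed the pairing on
    \<open>G\<close>.\<close>
  have graph: "((a, b), inner a b + (norm (a, b))\<^sup>2 / 2) \<in> K" if "(a, b) \<in> G" for a b
    unfolding K
  proof (intro allI impI)
    fix a' b' assume "(a', b') \<in> G"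
    then show "inner (a, b) (b', a') - inner a' b' + (norm (a, b))\<^sup>2 / 2
        \<le> inner a b + (norm (a, b))\<^sup>2 / 2"
      using mono[OF that, of a' b'] by (simp add: inner_simps inner_commute)
  qed
  \<comment> \<open>For empty \<open>G\<close> the premise of \<open>maximal\<close> would hold
    vacuously for every pair.\<close>
  have "G \<noteq> {}"
    using maximal by auto
  have "closed K"
  proof -
    have "K = (\<Inter>(a, b)\<in>G. {p. inner (fst p) (b, a) - inner a b + (norm (fst p))\<^sup>2 / 2 \<le> snd p})"
      by (auto simp: K_def)
    moreover have "closed {p :: ('a \<times> 'a) \<times> real. inner (fst p) (b, a) - inner a b + (norm (fst p))\<^sup>2 / 2 \<le> snd p}"
      for a b
      by (intro closed_Collect_le continuous_intros) auto
    ultimately show ?thesis by auto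
  qed
  moreover have "K \<noteq> {}"
    using graph \<open>G \<noteq> {}\<close> by fastforce
  moreover have "0 \<le> t" if "(z, t) \<in> K" for z t
  proof -
    obtain x u where z: "z = (x, u)" by fastforce
    have "0 \<le> (norm (x + u))\<^sup>2" by simp
    also have "\<dots> = 2 * inner x u + (norm (x, u))\<^sup>2"
      by (simp add: power2_norm_eq_inner inner_simps inner_commute)
    finally show ?thesis using above[of x u t] that z by simp
  qed
  moreover have "((1 - s) *\<^sub>R z + s *\<^sub>R z',
      (1 - s) * t + s * t' - 1/2 * (s * (1 - s) * (norm (z - z'))\<^sup>2)) \<in> K"
    if "(z, t) \<in> K" "(z', t') \<in> K" "0 < s" "s < 1" for z t z' t' s
    unfolding K
  proof (intro allI impI)
    fix a b assume ab: "(a, b) \<in> G"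
    have "(1 - s) * (inner z (b, a) - inner a b + (norm z)\<^sup>2 / 2)
        + s * (inner z' (b, a) - inner a b + (norm z')\<^sup>2 / 2) \<le> (1 - s) * t + s * t'"
      using that ab K by (intro add_mono mult_left_mono) auto
    moreover have "inner ((1 - s) *\<^sub>R z + s *\<^sub>R z') (b, a)
        = (1 - s) * inner z (b, a) + s * inner z' (b, a)"
      by (simp only: inner_add_left inner_scaleR_left)
    ultimately show "inner ((1 - s) *\<^sub>R z + s *\<^sub>R z') (b, a) - inner a b
        + (norm ((1 - s) *\<^sub>R z + s *\<^sub>R z'))\<^sup>2 / 2
        \<le> (1 - s) * t + s * t' - 1/2 * (s * (1 - s) * (norm (z - z'))\<^sup>2)"
      unfolding norm_convex_combination by (simp add: algebra_simps add_divide_distrib diff_divide_distrib)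
  qed
  moreover have "0 < (1/2 :: real)" by simp
  ultimately obtain z0 t0 where z0: "(z0, t0) \<in> K"
    and min: "\<And>z t. (z, t) \<in> K \<Longrightarrow> t0 + 1/2 * (norm (z - z0))\<^sup>2 \<le> t"
    using strongly_convex_epigraph_minimum[of K "1/2" 0] by metis
  obtain x u where xu: "z0 = (x, u)" by fastforce
  \<comment> \<open>Weighs the growth at the minimum against the points of \<open>K\<close> above
    \<open>G\<close>, with \<open>above\<close> bounding \<open>t0\<close> from below. So
    \<open>(- u, - x)\<close> is monotonically related to \<open>G\<close>, and the inequality at
    that very pair gives \<open>x + u = 0\<close>.\<close>
  have key: "(norm (x + u))\<^sup>2 \<le> inner (a + u) (b + x)" if "(a, b) \<in> G" for a b
  proof -
    have "t0 + 1/2 * (norm ((a, b) - (x, u)))\<^sup>2 \<le> inner a b + (norm (a, b))\<^sup>2 / 2"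
      using min[OF graph[OF that]] by (simp add: xu)
    then show ?thesis
      using above[of x u t0] z0
      by (simp add: xu power2_norm_eq_inner inner_simps inner_commute field_simps)
  qed
  have "(- u, - x) \<in> G"
  proof (rule maximal)
    fix a b assume "(a, b) \<in> G"
    then have "0 \<le> inner (a + u) (b + x)"
      using key[of a b] order_trans zero_le_power2 by blast
    then show "0 \<le> inner (- u - a) (- x - b)"
      by (simp add: inner_simps inner_commute)
  qed
  moreover from key[OF this] have "x + u = 0"
    by simp
  ultimately show thesis
    using that[of x] by (simp add: add_eq_0_iff)
qed

section \<open>Resolvents of maximally \<alpha>-monotone operators\<close>

lemma mem_resolvent: "p \<in> resolvent c A z \<longleftrightarrow> (\<exists>a\<in>A p. z = p + c *\<^sub>R a)"
  by (auto simp: resolvent_def op_inverse_def id_plus_def set_plus_def)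

lemma alpha_monotoneD:
  assumes "alpha_monotone \<alpha> A" "u \<in> A x" "v \<in> A y"
  shows "\<alpha> * (norm (x - y))\<^sup>2 \<le> inner (x - y) (u - v)"
  using assms by (auto simp: alpha_monotone_def op_graph_def)

text \<open>Otherwise \<open>?B\<close>, which adjoins the single pair \<open>(x, u)\<close> to the
  graph, would be a proper \<alpha>-monotone extension.\<close>

lemma maximally_alpha_monotoneD:
  assumes A: "maximally_alpha_monotone \<alpha> A"
    and related: "\<And>y v. v \<in> A y \<Longrightarrow> \<alpha> * (norm (x - y))\<^sup>2 \<le> inner (x - y) (u - v)"
  shows "u \<in> A x"
proof (rule ccontr)
  assume u: "u \<notin> A x"
  let ?B = "A(x := insert u (A x))"
  have "alpha_monotone \<alpha> A"
    using A by (simp add: maximally_alpha_monotone_def)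
  note mono = alpha_monotoneD[OF this]
  have "\<alpha> * (norm (y - y'))\<^sup>2 \<le> inner (y - y') (v - v')" if "v \<in> ?B y" "v' \<in> ?B y'" for y v y' v'
  proof -
    consider "v \<in> A y" "v' \<in> A y'" | "y = x" "v = u" "v' \<in> A y'" | "y' = x" "v' = u" "v \<in> A y"
      | "y = x" "v = u" "y' = x" "v' = u"
      using \<open>v \<in> ?B y\<close> \<open>v' \<in> ?B y'\<close> by (auto split: if_splits)
    then show ?thesis
    proof cases
      case 3
      then have "inner (y - y') (v - v') = inner (x - y) (u - v)"
        by (simp add: inner_simps inner_commute)
      then show ?thesis using related[OF \<open>v \<in> A y\<close>] 3 by (simp add: norm_minus_commute)
    qed (use mono related in auto)
  qed
  then have "alpha_monotone \<alpha> ?B"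
    unfolding alpha_monotone_def op_graph_def by blast
  moreover have "op_graph A \<subset> op_graph ?B"
    using u by (auto simp: op_graph_def)
  ultimately show False
    using A by (auto simp: maximally_alpha_monotone_def)
qed

text \<open>Existence is Minty's theorem for a rescaled \<open>A - \<alpha> Id\<close>. Uniqueness
  holds because \<open>Id + c A\<close> is strongly monotone with modulus
  \<open>1 + c * \<alpha>\<close>.\<close>

lemma resolvent_singleton:
  fixes A :: "'a::{real_inner, complete_space} \<Rightarrow> 'a set"
  assumes A: "maximally_alpha_monotone \<alpha> A" and c: "0 < c" and pos: "0 < 1 + c * \<alpha>"
  shows "is_singleton (resolvent c A z)"
proof -
  have amono: "alpha_monotone \<alpha> A"
    using A by (simp add: maximally_alpha_monotone_def)
  define d where "d = 1 + c * \<alpha>"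
  have d: "0 < d" using pos by (simp add: d_def)
  \<comment> \<open>Up to scaling and translation, \<open>G\<close> is the graph of \<open>A - \<alpha> Id\<close>.\<close>
  define G where "G = {(x, b). (1 / c) *\<^sub>R (d *\<^sub>R b + z) + \<alpha> *\<^sub>R x \<in> A x}"
  have eq: "inner (x - y) (((1 / c) *\<^sub>R (d *\<^sub>R b + z) + \<alpha> *\<^sub>R x) - ((1 / c) *\<^sub>R (d *\<^sub>R b' + z) + \<alpha> *\<^sub>R y))
      = \<alpha> * (norm (x - y))\<^sup>2 + d / c * inner (x - y) (b - b')" for x y b b'
    by (simp add: power2_norm_eq_inner inner_simps inner_commute algebra_simps add_divide_distrib diff_divide_distrib)
  have dc: "0 < d / c" using d c by simp
  \<comment> \<open>The scaling by \<open>d\<close> is chosen for this pair: with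
    \<open>b = - x\<close> the defining element of \<open>A x\<close> collapses to
    \<open>(z - x) / c\<close>.\<close>
  obtain x where "(x, - x) \<in> G"
  proof (rule minty_graph[of G])
    fix a b a' b' assume "(a, b) \<in> G" "(a', b') \<in> G"
    then have "0 \<le> d / c * inner (a - a') (b - b')"
      using alpha_monotoneD[OF amono] eq[of a a' b b'] by (fastforce simp: G_def)
    then show "0 \<le> inner (a - a') (b - b')"
      using dc by (metis linorder_not_le mult_pos_neg)
  next
    fix a b assume related: "\<And>a' b'. (a', b') \<in> G \<Longrightarrow> 0 \<le> inner (a - a') (b - b')"
    have "(1 / c) *\<^sub>R (d *\<^sub>R b + z) + \<alpha> *\<^sub>R a \<in> A a"
    proof (rule maximally_alpha_monotoneD[OF A])
      fix y v assume v: "v \<in> A y"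
      define b' where "b' = (1 / d) *\<^sub>R (c *\<^sub>R (v - \<alpha> *\<^sub>R y) - z)"
      have v_eq: "(1 / c) *\<^sub>R (d *\<^sub>R b' + z) + \<alpha> *\<^sub>R y = v"
        using c d by (simp add: b'_def)
      then have "0 \<le> d / c * inner (a - y) (b - b')"
        using v dc related[of y b'] by (intro mult_nonneg_nonneg) (simp_all add: G_def)
      then show "\<alpha> * (norm (a - y))\<^sup>2 \<le> inner (a - y) ((1 / c) *\<^sub>R (d *\<^sub>R b + z) + \<alpha> *\<^sub>R a - v)"
        using eq[of a y b b'] by (simp add: v_eq)
    qed
    then show "(a, b) \<in> G" by (simp add: G_def)
  qed auto
  then have "(1 / c) *\<^sub>R (d *\<^sub>R (- x) + z) + \<alpha> *\<^sub>R x \<in> A x" by (simp add: G_def)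
  moreover have "z = x + c *\<^sub>R ((1 / c) *\<^sub>R (d *\<^sub>R (- x) + z) + \<alpha> *\<^sub>R x)"
    using c by (simp add: d_def algebra_simps)
  ultimately have x: "x \<in> resolvent c A z"
    unfolding mem_resolvent by blast
  have "y = x" if y: "y \<in> resolvent c A z" for y
  proof -
    obtain a b where a: "a \<in> A x" "z = x + c *\<^sub>R a" and b: "b \<in> A y" "z = y + c *\<^sub>R b"
      using x y unfolding mem_resolvent by blast
    have "c *\<^sub>R (a - b) = y - x" using a b by (simp add: algebra_simps)
    then have "c * inner (x - y) (a - b) = - (norm (x - y))\<^sup>2"
      by (metis inner_minus_right inner_scaleR_right minus_diff_eq power2_norm_eq_inner)
    moreover have "c * (\<alpha> * (norm (x - y))\<^sup>2) \<le> c * inner (x - y) (a - b)"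
      using alpha_monotoneD[OF amono a(1) b(1)] c by simp
    ultimately have "(1 + c * \<alpha>) * (norm (x - y))\<^sup>2 \<le> 0"
      by (simp add: algebra_simps)
    then show ?thesis
      using pos by (simp add: mult_le_0_iff)
  qed
  with x have "resolvent c A z = {x}" by blast
  then show ?thesis by simp
qed

text \<open>The decrements of \<open>a\<close>, a decreasing sequence bounded below, tend to 0 and
  dominate \<open>e\<close>.\<close>

lemma tendsto_zero_if_telescoping:
  fixes a e :: "nat \<Rightarrow> real"
  assumes "\<And>k. 0 \<le> a k" and e: "\<And>k. 0 \<le> e k" and step: "\<And>k. a (Suc k) + e k \<le> a k"
  shows "e \<longlonglongrightarrow> 0"
proof -
  have "decseq a"
    using step e by (intro decseq_SucI) (metis add_increasing2 order_trans le_add_same_cancel1)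
  then obtain l where l: "a \<longlonglongrightarrow> l"
    using assms(1) decseq_convergent by blast
  have "(\<lambda>k. a k - a (Suc k)) \<longlonglongrightarrow> l - l"
    using l LIMSEQ_Suc by (intro tendsto_diff) auto
  then have lim: "(\<lambda>k. a k - a (Suc k)) \<longlonglongrightarrow> 0" by simp
  have "e k \<le> a k - a (Suc k)" for k
    using step[of k] by linarith
  then show ?thesis
    using e by (intro tendsto_sandwich[OF _ _ tendsto_const lim] always_eventually allI)
qed

subsection \<open>Asymptotic centres and Opial's theorem\<close>

text \<open>The epigraph of the function sending \<open>c\<close> to the upper limit of
  \<open>(norm (z k - c))\<^sup>2\<close>; its lowest point is the asymptotic centre of
  \<open>z\<close>.\<close>

definition asymptotic_bounds :: "(nat \<Rightarrow> 'a::real_inner) \<Rightarrow> ('a \<times> real) set" where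
  "asymptotic_bounds z = {(c, r). \<forall>e>0. \<forall>\<^sub>F k in sequentially. (norm (z k - c))\<^sup>2 \<le> r + e}"

lemma asymptotic_boundsI:
  assumes le: "\<forall>\<^sub>F k in sequentially. (norm (z k - c))\<^sup>2 \<le> f k" and f: "f \<longlonglongrightarrow> r"
  shows "(c, r) \<in> asymptotic_bounds z"
proof -
  have "\<forall>\<^sub>F k in sequentially. (norm (z k - c))\<^sup>2 \<le> r + e" if "0 < e" for e
    using le order_tendstoD(2)[OF f, of "r + e"] that by (auto elim: eventually_elim2)
  then show ?thesis by (auto simp: asymptotic_bounds_def)
qed

lemma asymptotic_boundsD:
  assumes "(c, r) \<in> asymptotic_bounds z" and lim: "(\<lambda>k. (norm (z k - c))\<^sup>2) \<longlonglongrightarrow> l"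
  shows "l \<le> r"
proof (rule field_le_epsilon)
  fix e :: real assume "0 < e"
  then have "\<forall>\<^sub>F k in sequentially. (norm (z k - c))\<^sup>2 \<le> r + e"
    using assms by (auto simp: asymptotic_bounds_def)
  then show "l \<le> r + e"
    using tendsto_upperbound[OF lim] by simp
qed

text \<open>Squared distances are strongly convex in the centre with the common constant 1, which
  survives the upper limit. Boundedness of \<open>z\<close> makes the epigraph closed and
  nonempty.\<close>

lemma asymptotic_center:
  fixes z :: "nat \<Rightarrow> 'a::{real_inner, complete_space}"
  assumes "bounded (range z)"
  obtains c r where "(c, r) \<in> asymptotic_bounds z"
    and "\<And>d t. (d, t) \<in> asymptotic_bounds z \<Longrightarrow> r + (norm (d - c))\<^sup>2 \<le> t"
proof -
  let ?K = "asymptotic_bounds z"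
  obtain M where M: "\<And>k. norm (z k) \<le> M"
    using assms by (auto simp: bounded_iff)
  have "closed ?K"
    unfolding closed_sequential_limits
  proof (intro allI impI, elim conjE)
    fix p :: "nat \<Rightarrow> 'a \<times> real" and l
    assume p: "\<forall>n. p n \<in> ?K" and l: "p \<longlonglongrightarrow> l"
    define c r where "c = fst l" and "r = snd l"
    have "\<forall>\<^sub>F k in sequentially. (norm (z k - c))\<^sup>2 \<le> r + e" if e: "0 < e" for e
    proof -
      \<comment> \<open>The height of \<open>p n\<close> plus an error, uniform in \<open>k\<close>,
        for moving the centre from \<open>fst (p n)\<close> to \<open>c\<close>. One good
        \<open>n\<close> suffices, half of \<open>e\<close> being kept for the upper limit.\<close>
      let ?f = "\<lambda>n. snd (p n) + (2 * (M + norm c) * norm (fst (p n) - c) + (norm (fst (p n) - c))\<^sup>2)"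
      have "?f \<longlonglongrightarrow> r + (2 * (M + norm c) * norm (c - c) + (norm (c - c))\<^sup>2)"
        unfolding c_def r_def by (intro tendsto_intros l)
      then have "?f \<longlonglongrightarrow> r" by simp
      then obtain n where n: "?f n < r + e / 2"
        using order_tendstoD(2)[of ?f r sequentially "r + e / 2"] e
        by (auto simp: eventually_sequentially)
      let ?c = "fst (p n)"
      have "\<forall>\<^sub>F k in sequentially. (norm (z k - ?c))\<^sup>2 \<le> snd (p n) + e / 2"
        using p[rule_format, of n] e by (auto simp: asymptotic_bounds_def split: prod.splits)
      then show ?thesis
      proof eventually_elim
        case (elim k)
        have "(norm (z k - c))\<^sup>2 = (norm (z k - ?c))\<^sup>2 + 2 * inner (z k - c) (?c - c) - (norm (?c - c))\<^sup>2"
          by (simp add: power2_norm_eq_inner inner_simps inner_commute)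
        moreover have "inner (z k - c) (?c - c) \<le> (M + norm c) * norm (?c - c)"
          using norm_cauchy_schwarz[of "z k - c" "?c - c"] norm_triangle_ineq4[of "z k" c] M[of k]
          by (smt (verit) mult_right_mono norm_ge_zero)
        then have "2 * inner (z k - c) (?c - c) \<le> 2 * (M + norm c) * norm (?c - c)"
          by (subst mult.assoc) (rule mult_left_mono, simp_all)
        ultimately show ?case
          using n elim zero_le_power2[of "norm (?c - c)"] by linarith
      qed
    qed
    then show "l \<in> ?K" by (auto simp: asymptotic_bounds_def c_def r_def split: prod.splits)
  qed
  moreover have "?K \<noteq> {}"
  proof -
    have "(0, M\<^sup>2) \<in> ?K"
      using M by (intro asymptotic_boundsI[where f = "\<lambda>_. M\<^sup>2"] always_eventually allI)
        (auto intro: power_mono)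
    then show ?thesis by blast
  qed
  moreover have "0 \<le> t" if "(d, t) \<in> ?K" for d t
  proof (rule field_le_epsilon)
    fix e :: real assume "0 < e"
    then have "\<forall>\<^sub>F k in sequentially. (norm (z k - d))\<^sup>2 \<le> t + e"
      using that by (simp add: asymptotic_bounds_def)
    then obtain k where "(norm (z k - d))\<^sup>2 \<le> t + e"
      using eventually_happens'[OF sequentially_bot] by blast
    then show "0 \<le> t + e" using zero_le_power2 order_trans by blast
  qed
  moreover have "((1 - s) *\<^sub>R d + s *\<^sub>R d',
      (1 - s) * t + s * t' - 1 * (s * (1 - s) * (norm (d - d'))\<^sup>2)) \<in> ?K"
    if dt: "(d, t) \<in> ?K" "(d', t') \<in> ?K" and s: "0 < s" "s < 1" for d t d' t' s
  proof -
    have "\<forall>\<^sub>F k in sequentially. (norm (z k - ((1 - s) *\<^sub>R d + s *\<^sub>R d')))\<^sup>2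
        \<le> (1 - s) * t + s * t' - 1 * (s * (1 - s) * (norm (d - d'))\<^sup>2) + e" if e: "0 < e" for e
    proof -
      have "\<forall>\<^sub>F k in sequentially. (norm (z k - d))\<^sup>2 \<le> t + e"
        "\<forall>\<^sub>F k in sequentially. (norm (z k - d'))\<^sup>2 \<le> t' + e"
        using dt e by (auto simp: asymptotic_bounds_def)
      then show ?thesis
      proof eventually_elim
        case (elim k)
        have "z k - ((1 - s) *\<^sub>R d + s *\<^sub>R d') = (1 - s) *\<^sub>R (z k - d) + s *\<^sub>R (z k - d')"
          by (simp add: algebra_simps)
        then have "(norm (z k - ((1 - s) *\<^sub>R d + s *\<^sub>R d')))\<^sup>2
            = (1 - s) * (norm (z k - d))\<^sup>2 + s * (norm (z k - d'))\<^sup>2 - s * (1 - s) * (norm (d - d'))\<^sup>2"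
          by (simp only: norm_convex_combination) (simp add: norm_minus_commute)
        moreover have "(1 - s) * (norm (z k - d))\<^sup>2 + s * (norm (z k - d'))\<^sup>2
            \<le> (1 - s) * (t + e) + s * (t' + e)"
          using elim s by (intro add_mono mult_left_mono) auto
        moreover have "(1 - s) * (t + e) + s * (t' + e) = (1 - s) * t + s * t' + e"
          by (simp add: algebra_simps)
        ultimately show ?case by linarith
      qed
    qed
    then show ?thesis by (auto simp: asymptotic_bounds_def)
  qed
  moreover have "0 < (1 :: real)" by simp
  ultimately obtain c r where "(c, r) \<in> ?K"
    and "\<And>d t. (d, t) \<in> ?K \<Longrightarrow> r + 1 * (norm (d - c))\<^sup>2 \<le> t"
    using strongly_convex_epigraph_minimum[of ?K 1 0] by metis
  then show thesis
    using that by simp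
qed

text \<open>As \<open>T (z k)\<close> approaches \<open>z k\<close> and \<open>T\<close> is
  nonexpansive, \<open>T c\<close> is asymptotically no farther from \<open>z\<close> than
  \<open>c\<close> is. Growth at the centre then leaves only \<open>T c = c\<close>.\<close>

lemma asymptotic_center_fixed_point:
  assumes nonexp: "\<And>a b. norm (T a - T b) \<le> norm (a - b)"
    and regular: "(\<lambda>k. T (z k) - z k) \<longlonglongrightarrow> 0"
    and bdd: "bounded (range z)"
    and c: "(c, r) \<in> asymptotic_bounds z"
    and center: "\<And>d t. (d, t) \<in> asymptotic_bounds z \<Longrightarrow> r + (norm (d - c))\<^sup>2 \<le> t"
  shows "T c = c"
proof -
  obtain M where M: "\<And>k. norm (z k) \<le> M"
    using bdd by (auto simp: bounded_iff)
  let ?d = "\<lambda>k. norm (T (z k) - z k)"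
  have le: "(norm (z k - T c))\<^sup>2 \<le> (norm (z k - c))\<^sup>2 + (?d k * (?d k + 2 * (M + norm c)))" for k
  proof -
    have "norm (z k - T c) \<le> ?d k + norm (T (z k) - T c)"
      using dist_triangle[of "z k" "T c" "T (z k)"] by (simp add: dist_norm norm_minus_commute)
    also have "\<dots> \<le> ?d k + norm (z k - c)"
      using nonexp by simp
    finally have "(norm (z k - T c))\<^sup>2 \<le> (?d k + norm (z k - c))\<^sup>2"
      by (intro power_mono) auto
    also have "\<dots> = (norm (z k - c))\<^sup>2 + ?d k * (?d k + 2 * norm (z k - c))"
      by (simp add: power2_eq_square algebra_simps)
    also have "\<dots> \<le> (norm (z k - c))\<^sup>2 + ?d k * (?d k + 2 * (M + norm c))"
      using norm_triangle_ineq4[of "z k" c] M[of k]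
      by (intro add_left_mono mult_left_mono) auto
    finally show ?thesis .
  qed
  have "(\<lambda>k. ?d k * (?d k + 2 * (M + norm c))) \<longlonglongrightarrow> 0 * (0 + 2 * (M + norm c))"
    by (intro tendsto_intros tendsto_norm_zero regular)
  then have lim: "(\<lambda>k. ?d k * (?d k + 2 * (M + norm c))) \<longlonglongrightarrow> 0" by simp
  have "\<forall>\<^sub>F k in sequentially. (norm (z k - T c))\<^sup>2 \<le> r + e" if e: "0 < e" for e
  proof -
    have "\<forall>\<^sub>F k in sequentially. (norm (z k - c))\<^sup>2 \<le> r + e / 2"
      using c e by (simp add: asymptotic_bounds_def)
    moreover have "\<forall>\<^sub>F k in sequentially. ?d k * (?d k + 2 * (M + norm c)) < e / 2"
      using order_tendstoD(2)[OF lim, of "e / 2"] e by simp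
    ultimately show ?thesis
    proof eventually_elim
      case (elim k)
      with le[of k] show ?case by linarith
    qed
  qed
  then have "(T c, r) \<in> asymptotic_bounds z"
    by (simp add: asymptotic_bounds_def)
  from center[OF this] show ?thesis by simp
qed

text \<open>
  Instead of weak compactness, the proof uses that the asymptotic centre of every subsequence
  is a fixed point, which forces all these centres to coincide.
\<close>
lemma opial_weak_convergence:
  fixes T :: "'a::{real_inner, complete_space} \<Rightarrow> 'a"
  assumes nonexp: "\<And>a b. norm (T a - T b) \<le> norm (a - b)"
    and fixed: "T f = f"
    and step: "\<And>k. z (Suc k) = T (z k)"
    and regular: "(\<lambda>k. T (z k) - z k) \<longlonglongrightarrow> 0"
  obtains c where "T c = c" and "weakly_convergent_to z c"
proof -
  have fejer: "\<exists>l. (\<lambda>k. (norm (z k - d))\<^sup>2) \<longlonglongrightarrow> l" if "T d = d" for d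
  proof -
    have "decseq (\<lambda>k. (norm (z k - d))\<^sup>2)"
      using nonexp[of _ d] that by (intro decseq_SucI power_mono) (auto simp: step)
    then show ?thesis
      using decseq_convergent[of "\<lambda>k. (norm (z k - d))\<^sup>2" 0] by auto
  qed
  have bdd: "bounded (range z)"
  proof -
    have "norm (z k - f) \<le> norm (z 0 - f)" for k
      using nonexp[of _ f] fixed by (induction k) (auto simp: step intro: order_trans)
    then have "norm (z k) \<le> norm f + norm (z 0 - f)" for k
      by (smt (verit) norm_triangle_sub)
    then show ?thesis by (auto simp: bounded_iff)
  qed
  obtain c r where c: "(c, r) \<in> asymptotic_bounds z"
    and center: "\<And>d t. (d, t) \<in> asymptotic_bounds z \<Longrightarrow> r + (norm (d - c))\<^sup>2 \<le> t"
    using asymptotic_center[OF bdd] by blast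
  have Tc: "T c = c"
    using asymptotic_center_fixed_point[OF nonexp regular bdd c center] .
  obtain D where D: "(\<lambda>k. (norm (z k - c))\<^sup>2) \<longlonglongrightarrow> D"
    using fejer[OF Tc] by blast
  have Dr: "D = r"
  proof (rule antisym)
    show "D \<le> r" using asymptotic_boundsD[OF c D] .
    have "(c, D) \<in> asymptotic_bounds z"
      by (rule asymptotic_boundsI[OF _ D]) simp
    from center[OF this] show "r \<le> D" by simp
  qed
  \<comment> \<open>The pairings with \<open>h\<close> can accumulate only at 0, because every
    subsequence has the same centre \<open>c\<close>.\<close>
  have sub: "L = 0" if \<tau>: "strict_mono \<tau>" and L: "(\<lambda>k. inner (z (\<tau> k) - c) h) \<longlonglongrightarrow> L" for \<tau> :: "nat \<Rightarrow> nat" and h L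
  proof -
    have bdd': "bounded (range (z \<circ> \<tau>))"
      using bdd by (rule bounded_subset) auto
    have regular': "(\<lambda>k. T ((z \<circ> \<tau>) k) - (z \<circ> \<tau>) k) \<longlonglongrightarrow> 0"
      using LIMSEQ_subseq_LIMSEQ[OF regular \<tau>] by (simp add: o_def)
    obtain c' r' where c': "(c', r') \<in> asymptotic_bounds (z \<circ> \<tau>)"
      and center': "\<And>d t. (d, t) \<in> asymptotic_bounds (z \<circ> \<tau>) \<Longrightarrow> r' + (norm (d - c'))\<^sup>2 \<le> t"
      using asymptotic_center[OF bdd'] by blast
    have "T c' = c'"
      using asymptotic_center_fixed_point[OF nonexp regular' bdd' c' center'] .
    then obtain D' where D': "(\<lambda>k. (norm (z k - c'))\<^sup>2) \<longlonglongrightarrow> D'"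
      using fejer by blast
    have D'\<tau>: "(\<lambda>k. (norm ((z \<circ> \<tau>) k - c'))\<^sup>2) \<longlonglongrightarrow> D'"
      and D\<tau>: "(\<lambda>k. (norm ((z \<circ> \<tau>) k - c))\<^sup>2) \<longlonglongrightarrow> D"
      using LIMSEQ_subseq_LIMSEQ[OF D' \<tau>] LIMSEQ_subseq_LIMSEQ[OF D \<tau>] by (simp_all add: o_def)
    \<comment> \<open>Distances to the fixed point \<open>c'\<close> converge along the whole
      sequence, so both centres can be tested against each other. With \<open>d\<close> the squared
      distance of the centres, \<open>r + d \<le> D' \<le> r'\<close> and
      \<open>r' + d \<le> D = r\<close>.\<close>
    have "D' \<le> r'" using asymptotic_boundsD[OF c' D'\<tau>] .
    moreover have "r + (norm (c' - c))\<^sup>2 \<le> D'"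
      by (rule center, rule asymptotic_boundsI[OF _ D']) simp
    moreover have "r' + (norm (c - c'))\<^sup>2 \<le> D"
      by (rule center', rule asymptotic_boundsI[OF _ D\<tau>]) simp
    ultimately have "(norm (c' - c))\<^sup>2 \<le> 0" and r': "D \<le> r'"
      using Dr zero_le_power2[of "norm (c' - c)"] unfolding norm_minus_commute[of c c']
      by linarith+
    then have c'c: "c' = c" by simp
    \<comment> \<open>Test the centre against \<open>c + t *\<^sub>R h\<close>. The quadratic terms
      cancel against the growth term, and opposite signs of \<open>t\<close> then give
      \<open>L = 0\<close>.\<close>
    have lin: "2 * t * L \<le> 0" for t
    proof -
      have "(\<lambda>k. (norm ((z \<circ> \<tau>) k - c))\<^sup>2 - 2 * t * inner (z (\<tau> k) - c) h + t\<^sup>2 * (norm h)\<^sup>2)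
          \<longlonglongrightarrow> D - 2 * t * L + t\<^sup>2 * (norm h)\<^sup>2"
        by (intro tendsto_intros D\<tau> L)
      moreover have "(norm ((z \<circ> \<tau>) k - (c + t *\<^sub>R h)))\<^sup>2
          = (norm ((z \<circ> \<tau>) k - c))\<^sup>2 - 2 * t * inner (z (\<tau> k) - c) h + t\<^sup>2 * (norm h)\<^sup>2" for k
        unfolding power2_norm_eq_inner
        by (simp add: inner_simps inner_commute power2_eq_square algebra_simps)
      ultimately have "(c + t *\<^sub>R h, D - 2 * t * L + t\<^sup>2 * (norm h)\<^sup>2) \<in> asymptotic_bounds (z \<circ> \<tau>)"
        by (intro asymptotic_boundsI) auto
      from center'[OF this] have "r' \<le> D - 2 * t * L"
        by (simp add: c'c power_mult_distrib)
      with r' show ?thesis by linarith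
    qed
    show "L = 0" using lin[of 1] lin[of "-1"] by simp
  qed
  have "(\<lambda>k. inner (z k - c) h) \<longlonglongrightarrow> 0" for h
  proof (rule ccontr)
    assume "\<not> ?thesis"
    then obtain e where e: "0 < e" and "\<not> (\<forall>\<^sub>F k in sequentially. \<bar>inner (z k - c) h\<bar> < e)"
      unfolding tendsto_iff by auto
    then obtain \<tau> :: "nat \<Rightarrow> nat" where \<tau>: "strict_mono \<tau>" and far: "\<And>k. \<not> \<bar>inner (z (\<tau> k) - c) h\<bar> < e"
      using not_eventually_sequentiallyD by blast
    obtain M where M: "\<And>k. norm (z k) \<le> M"
      using bdd by (auto simp: bounded_iff)
    have "\<bar>inner (z (\<tau> k) - c) h\<bar> \<le> (M + norm c) * norm h" for k
      using Cauchy_Schwarz_ineq2[of "z (\<tau> k) - c" h] norm_triangle_ineq4[of "z (\<tau> k)" c] M[of "\<tau> k"]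
      by (smt (verit) mult_right_mono norm_ge_zero)
    then have "bounded (range (\<lambda>k. inner (z (\<tau> k) - c) h))"
      by (auto simp: bounded_iff)
    then obtain L \<rho> where \<rho>: "strict_mono (\<rho> :: nat \<Rightarrow> nat)"
      and L: "((\<lambda>k. inner (z (\<tau> k) - c) h) \<circ> \<rho>) \<longlonglongrightarrow> L"
      using bounded_imp_convergent_subsequence by blast
    have "L = 0"
      using sub[of "\<tau> \<circ> \<rho>" h L] \<tau> \<rho> L by (auto simp: o_def strict_mono_def)
    then have "\<forall>\<^sub>F k in sequentially. \<bar>inner (z (\<tau> (\<rho> k)) - c) h\<bar> < e"
      using L e unfolding tendsto_iff by (auto simp: o_def)
    then show False
      using far by (auto simp: eventually_sequentially)
  qed
  then have "(\<lambda>k. inner (z k - c) h + inner c h) \<longlonglongrightarrow> 0 + inner c h" for h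
    by (intro tendsto_intros) auto
  then have "weakly_convergent_to z c"
    by (simp add: weakly_convergent_to_def inner_simps)
  with Tc show thesis by (rule that)
qed

subsection \<open>Ryu splitting for strongly monotone operators\<close>

text \<open>The trace that \<mu>-strong monotonicity of an operator leaves on its resolvent
  \<open>J\<close> with parameter 1: \<open>x - J x\<close> is a value of the operator at
  \<open>J x\<close>.\<close>

definition strong_resolvent :: "real \<Rightarrow> ('a::real_inner \<Rightarrow> 'a) \<Rightarrow> bool" where
  "strong_resolvent \<mu> J \<longleftrightarrow>
    (\<forall>x y. \<mu> * (norm (J x - J y))\<^sup>2 \<le> inner (J x - J y) ((x - J x) - (y - J y)))"

lemma strong_resolventD:
  assumes "strong_resolvent \<mu> J" and "J x = a" and "J y = b"
  shows "\<mu> * (norm (a - b))\<^sup>2 \<le> inner (a - b) ((x - a) - (y - b))"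
  using assms by (auto simp: strong_resolvent_def)

definition ryu_v :: "('a \<Rightarrow> 'a) \<Rightarrow> ('a \<Rightarrow> 'a) \<Rightarrow> 'a \<times> 'a \<Rightarrow> 'a::real_vector" where
  "ryu_v JA JB z = JB (JA (fst z) + snd z)"

definition ryu_w :: "('a \<Rightarrow> 'a) \<Rightarrow> ('a \<Rightarrow> 'a) \<Rightarrow> ('a \<Rightarrow> 'a) \<Rightarrow> 'a \<times> 'a \<Rightarrow> 'a::real_vector" where
  "ryu_w JA JB JC z = JC (JA (fst z) - fst z + ryu_v JA JB z - snd z)"

text \<open>Pairing the two governing sequences makes the step a self-map of the product Hilbert
  space, where Opial's theorem applies.\<close>

definition ryu_step ::
    "real \<Rightarrow> ('a \<Rightarrow> 'a) \<Rightarrow> ('a \<Rightarrow> 'a) \<Rightarrow> ('a \<Rightarrow> 'a) \<Rightarrow> 'a \<times> 'a \<Rightarrow> 'a \<times> 'a::real_vector" where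
  "ryu_step lam JA JB JC z =
    (fst z + lam *\<^sub>R (ryu_w JA JB JC z - JA (fst z)),
     snd z + lam *\<^sub>R (ryu_w JA JB JC z - ryu_v JA JB z))"

text \<open>Meant for differences of two runs: strong monotonicity bounds the three inner products
  from below, and the remaining \<open>lam\<close> terms are nonnegative for \<open>lam\<close>
  between 0 and 1.\<close>

lemma ryu_identity:
  fixes x y u v w :: "'a::real_inner"
  shows "(norm (x + lam *\<^sub>R (w - u)))\<^sup>2 + (norm (y + lam *\<^sub>R (w - v)))\<^sup>2
      + 2 * lam * (inner u (x - u) + inner v (u + y - v) + inner w (u - x + v - y - w))
      + lam * (1 - lam) * ((norm (w - u))\<^sup>2 + (norm (w - v))\<^sup>2) + lam * (norm (u - v))\<^sup>2
    = (norm x)\<^sup>2 + (norm y)\<^sup>2"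
  unfolding power2_norm_eq_inner by (simp add: inner_simps inner_commute algebra_simps)

lemma ryu_step_estimate:
  fixes z z' :: "'a::real_inner \<times> 'a"
  assumes A: "strong_resolvent \<mu>A JA" and B: "strong_resolvent \<mu>B JB" and C: "strong_resolvent \<mu>C JC"
    and lam: "0 < lam" "lam \<le> 1"
  shows "(norm (ryu_step lam JA JB JC z - ryu_step lam JA JB JC z'))\<^sup>2
      + 2 * lam * (\<mu>A * (norm (JA (fst z) - JA (fst z')))\<^sup>2
        + \<mu>B * (norm (ryu_v JA JB z - ryu_v JA JB z'))\<^sup>2
        + \<mu>C * (norm (ryu_w JA JB JC z - ryu_w JA JB JC z'))\<^sup>2)
    \<le> (norm (z - z'))\<^sup>2"
proof -
  obtain x y x' y' where z: "z = (x, y)" "z' = (x', y')" by fastforce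
  define u u' where u: "u = JA x" "u' = JA x'"
  define v v' where v: "v = ryu_v JA JB z" "v' = ryu_v JA JB z'"
  define w w' where w: "w = ryu_w JA JB JC z" "w' = ryu_w JA JB JC z'"
  define S where "S = inner (u - u') (x - x' - (u - u'))
    + inner (v - v') ((u - u') + (y - y') - (v - v'))
    + inner (w - w') ((u - u') - (x - x') + (v - v') - (y - y') - (w - w'))"
  have "\<mu>A * (norm (u - u'))\<^sup>2 \<le> inner (u - u') ((x - u) - (x' - u'))"
    using strong_resolventD[OF A] u by blast
  moreover have "\<mu>B * (norm (v - v'))\<^sup>2 \<le> inner (v - v') ((u + y - v) - (u' + y' - v'))"
    by (rule strong_resolventD[OF B]) (simp_all add: u v z ryu_v_def)
  moreover have "\<mu>C * (norm (w - w'))\<^sup>2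
      \<le> inner (w - w') ((u - x + v - y - w) - (u' - x' + v' - y' - w'))"
    by (rule strong_resolventD[OF C]) (simp_all add: u v w z ryu_w_def)
  ultimately have "\<mu>A * (norm (u - u'))\<^sup>2 + \<mu>B * (norm (v - v'))\<^sup>2 + \<mu>C * (norm (w - w'))\<^sup>2 \<le> S"
    unfolding S_def by (simp add: algebra_simps)
  then have "2 * lam * (\<mu>A * (norm (u - u'))\<^sup>2 + \<mu>B * (norm (v - v'))\<^sup>2 + \<mu>C * (norm (w - w'))\<^sup>2)
      \<le> 2 * lam * S"
    using lam by simp
  moreover have "0 \<le> lam * (1 - lam) * ((norm (w - w' - (u - u')))\<^sup>2 + (norm (w - w' - (v - v')))\<^sup>2)
      + lam * (norm ((u - u') - (v - v')))\<^sup>2"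
    using lam by simp
  moreover have "ryu_step lam JA JB JC z - ryu_step lam JA JB JC z'
      = (x - x' + lam *\<^sub>R (w - w' - (u - u')), y - y' + lam *\<^sub>R (w - w' - (v - v')))"
    unfolding ryu_step_def w[symmetric] v[symmetric] by (simp add: z u algebra_simps)
  moreover have "(norm (z - z'))\<^sup>2 = (norm (x - x'))\<^sup>2 + (norm (y - y'))\<^sup>2"
    by (simp add: z norm_Pair)
  ultimately show ?thesis
    using ryu_identity[of "x - x'" lam "w - w'" "u - u'" "y - y'" "v - v'"]
    unfolding w[symmetric] v[symmetric]
    by (simp add: z u norm_Pair S_def)
qed

text \<open>Between two fixed points the distance does not drop, so the modulus terms of the
  estimate vanish. This identifies the image under \<open>JA\<close>, not the fixed point
  itself.\<close>

lemma ryu_fixed_point_unique: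
  assumes "strong_resolvent \<mu>A JA" "strong_resolvent \<mu>B JB" "strong_resolvent \<mu>C JC"
    and \<mu>: "0 < \<mu>A" "0 < \<mu>B" "0 < \<mu>C" and lam: "0 < lam" "lam \<le> 1"
    and fixed: "ryu_step lam JA JB JC z = z" "ryu_step lam JA JB JC z' = z'"
  shows "JA (fst z) = JA (fst z')"
proof -
  let ?a = "\<mu>A * (norm (JA (fst z) - JA (fst z')))\<^sup>2"
  let ?b = "\<mu>B * (norm (ryu_v JA JB z - ryu_v JA JB z'))\<^sup>2"
  let ?c = "\<mu>C * (norm (ryu_w JA JB JC z - ryu_w JA JB JC z'))\<^sup>2"
  have "2 * lam * (?a + ?b + ?c) \<le> 0"
    using ryu_step_estimate[OF assms(1-3) lam, of z z'] fixed by simp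
  then have "?a + ?b + ?c \<le> 0"
    using lam by (simp add: mult_le_0_iff)
  moreover have "0 \<le> ?b" "0 \<le> ?c" using \<mu> by auto
  ultimately have "?a \<le> 0" by linarith
  then show ?thesis using \<mu> by (simp add: mult_le_0_iff)
qed

text \<open>The estimate against \<open>f\<close> telescopes, so all three modulus terms vanish in
  the limit. The increments of \<open>z\<close> are multiples of differences of sequences with the
  common limit \<open>p\<close>, which is the regularity that Opial's theorem asks for.\<close>

lemma ryu_convergence:
  fixes z :: "nat \<Rightarrow> 'a::{real_inner, complete_space} \<times> 'a"
  assumes J: "strong_resolvent \<mu>A JA" "strong_resolvent \<mu>B JB" "strong_resolvent \<mu>C JC"
    and \<mu>: "0 < \<mu>A" "0 < \<mu>B" "0 < \<mu>C" and lam: "0 < lam" "lam \<le> 1"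
    and f: "JA (fst f) = p" "ryu_v JA JB f = p" "ryu_w JA JB JC f = p"
    and step: "\<And>k. z (Suc k) = ryu_step lam JA JB JC (z k)"
  shows "(\<lambda>k. JA (fst (z k))) \<longlonglongrightarrow> p"
    and "\<exists>c. JA (fst c) = p \<and> weakly_convergent_to z c"
proof -
  let ?T = "ryu_step lam JA JB JC"
  let ?a = "\<lambda>k. \<mu>A * (norm (JA (fst (z k)) - p))\<^sup>2"
  let ?b = "\<lambda>k. \<mu>B * (norm (ryu_v JA JB (z k) - p))\<^sup>2"
  let ?c = "\<lambda>k. \<mu>C * (norm (ryu_w JA JB JC (z k) - p))\<^sup>2"
  have fixed: "?T f = f"
    unfolding ryu_step_def f by simp
  have "(norm (z (Suc k) - f))\<^sup>2 + 2 * lam * (?a k + ?b k + ?c k) \<le> (norm (z k - f))\<^sup>2" for k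
    using ryu_step_estimate[OF J lam, of "z k" f] by (simp add: fixed f step)
  then have "(\<lambda>k. 2 * lam * (?a k + ?b k + ?c k)) \<longlonglongrightarrow> 0"
    using lam \<mu> by (intro tendsto_zero_if_telescoping[of "\<lambda>k. (norm (z k - f))\<^sup>2"]) auto
  then have sum0: "(\<lambda>k. ?a k + ?b k + ?c k) \<longlonglongrightarrow> 0"
    using lam by (simp add: tendsto_mult_left_iff[of "2 * lam" _ 0, simplified])
  have lim: "g \<longlonglongrightarrow> p" if "\<And>k. m * (norm (g k - p))\<^sup>2 \<le> ?a k + ?b k + ?c k" "0 < m" for g m
  proof -
    have "(\<lambda>k. m * (norm (g k - p))\<^sup>2) \<longlonglongrightarrow> 0"
      using that sum0 by (intro tendsto_sandwich[OF _ _ tendsto_const sum0]) auto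
    then have "(\<lambda>k. sqrt ((norm (g k - p))\<^sup>2)) \<longlonglongrightarrow> sqrt 0"
      using that(2) by (intro tendsto_real_sqrt) (simp add: tendsto_mult_left_iff[of m _ 0, simplified])
    then show ?thesis by (simp add: tendsto_norm_zero_iff LIM_zero_iff)
  qed
  have u: "(\<lambda>k. JA (fst (z k))) \<longlonglongrightarrow> p" by (rule lim[OF _ \<mu>(1)]) (use \<mu> in simp)
  have v: "(\<lambda>k. ryu_v JA JB (z k)) \<longlonglongrightarrow> p" by (rule lim[OF _ \<mu>(2)]) (use \<mu> in simp)
  have w: "(\<lambda>k. ryu_w JA JB JC (z k)) \<longlonglongrightarrow> p" by (rule lim[OF _ \<mu>(3)]) (use \<mu> in simp)
  show "(\<lambda>k. JA (fst (z k))) \<longlonglongrightarrow> p" by (rule u)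
  have nonexp: "norm (?T a - ?T b) \<le> norm (a - b)" for a b
  proof (rule power2_le_imp_le)
    have "0 \<le> 2 * lam * (\<mu>A * (norm (JA (fst a) - JA (fst b)))\<^sup>2
        + \<mu>B * (norm (ryu_v JA JB a - ryu_v JA JB b))\<^sup>2
        + \<mu>C * (norm (ryu_w JA JB JC a - ryu_w JA JB JC b))\<^sup>2)"
      using \<mu> lam by simp
    then show "(norm (?T a - ?T b))\<^sup>2 \<le> (norm (a - b))\<^sup>2"
      using ryu_step_estimate[OF J lam, of a b] by linarith
  qed simp
  have "(\<lambda>k. (lam *\<^sub>R (ryu_w JA JB JC (z k) - JA (fst (z k))),
      lam *\<^sub>R (ryu_w JA JB JC (z k) - ryu_v JA JB (z k)))) \<longlonglongrightarrow> (lam *\<^sub>R (p - p), lam *\<^sub>R (p - p))"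
    by (intro tendsto_intros u v w)
  moreover have "?T (z k) - z k = (lam *\<^sub>R (ryu_w JA JB JC (z k) - JA (fst (z k))),
      lam *\<^sub>R (ryu_w JA JB JC (z k) - ryu_v JA JB (z k)))" for k
    by (cases "z k") (simp add: ryu_step_def)
  ultimately have regular: "(\<lambda>k. ?T (z k) - z k) \<longlonglongrightarrow> 0"
    by (simp add: zero_prod_def)
  obtain c where "?T c = c" "weakly_convergent_to z c"
    using opial_weak_convergence[OF nonexp fixed step regular] by blast
  then show "\<exists>c. JA (fst c) = p \<and> weakly_convergent_to z c"
    using ryu_fixed_point_unique[OF J \<mu> lam _ fixed] f by blast
qed

lemma weakly_convergent_to_fst:
  assumes "weakly_convergent_to z c"
  shows "weakly_convergent_to (\<lambda>k. fst (z k)) (fst c)"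
  unfolding weakly_convergent_to_def
proof
  fix h
  show "(\<lambda>k. inner (fst (z k)) h) \<longlonglongrightarrow> inner (fst c) h"
    using assms[unfolded weakly_convergent_to_def, rule_format, of "(h, 0)"]
    by (simp add: inner_prod_def)
qed

subsection \<open>Regularized resolvents\<close>

text \<open>This is the resolvent of \<open>\<theta> A + \<sigma> (Id - q)\<close> with parameter \<open>\<gamma>\<close>.\<close>
definition regularized_resolvent ::
    "real \<Rightarrow> real \<Rightarrow> real \<Rightarrow> 'a \<Rightarrow> ('a \<Rightarrow> 'a set) \<Rightarrow> 'a \<Rightarrow> 'a::real_vector" where
  "regularized_resolvent \<gamma> \<theta> \<sigma> q A x =
    the_elem (resolvent (\<gamma> * \<theta> / (1 + \<gamma> * \<sigma>)) A
      ((1 / (1 + \<gamma> * \<sigma>)) *\<^sub>R x + (\<gamma> * \<sigma> / (1 + \<gamma> * \<sigma>)) *\<^sub>R q))"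

locale regularized_operator =
  fixes A :: "'a::{real_inner, complete_space} \<Rightarrow> 'a set" and \<alpha> \<theta> \<sigma> \<gamma> :: real
  assumes maximal: "maximally_alpha_monotone \<alpha> A"
    and \<theta>: "0 < \<theta>" and \<sigma>: "0 < \<sigma>" and \<gamma>: "0 < \<gamma>" and modulus: "0 < \<theta> * \<alpha> + \<sigma>"
begin

lemma denominator_pos: "0 < 1 + \<gamma> * \<sigma>"
  using \<sigma> \<gamma> by (simp add: add_pos_pos)

lemma singleton: "is_singleton (resolvent (\<gamma> * \<theta> / (1 + \<gamma> * \<sigma>)) A z)"
proof (rule resolvent_singleton[OF maximal])
  show "0 < \<gamma> * \<theta> / (1 + \<gamma> * \<sigma>)"
    using denominator_pos \<theta> \<gamma> by simp
  \<comment> \<open>This is the required positive quantity multiplied by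
    \<open>1 + \<gamma> * \<sigma>\<close>.\<close>
  have "0 < 1 + \<gamma> * (\<theta> * \<alpha> + \<sigma>)"
    using \<gamma> modulus by (simp add: add_pos_pos)
  then show "0 < 1 + \<gamma> * \<theta> / (1 + \<gamma> * \<sigma>) * \<alpha>"
    using denominator_pos by (simp add: field_simps)
qed

text \<open>Multiplying the resolvent equation by \<open>1 + \<gamma> * \<sigma>\<close> turns the
  averaging with \<open>q\<close> into the term \<open>\<sigma> *\<^sub>R (p - q)\<close> of the
  operator.\<close>

lemma regularized_resolvent_eq_iff:
  "regularized_resolvent \<gamma> \<theta> \<sigma> q A x = p \<longleftrightarrow> (\<exists>a\<in>A p. x - p = \<gamma> *\<^sub>R (\<theta> *\<^sub>R a + \<sigma> *\<^sub>R (p - q)))"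
proof -
  let ?s = "1 + \<gamma> * \<sigma>"
  let ?z = "(1 / ?s) *\<^sub>R x + (\<gamma> * \<sigma> / ?s) *\<^sub>R q"
  obtain p' where p': "resolvent (\<gamma> * \<theta> / ?s) A ?z = {p'}"
    using singleton is_singletonE by blast
  have "?z = p + (\<gamma> * \<theta> / ?s) *\<^sub>R a \<longleftrightarrow> x - p = \<gamma> *\<^sub>R (\<theta> *\<^sub>R a + \<sigma> *\<^sub>R (p - q))" for a
  proof -
    have s: "?s \<noteq> 0" using denominator_pos by simp
    have "?z = p + (\<gamma> * \<theta> / ?s) *\<^sub>R a \<longleftrightarrow> ?s *\<^sub>R ?z = ?s *\<^sub>R (p + (\<gamma> * \<theta> / ?s) *\<^sub>R a)"
      using s by (simp only: scaleR_cancel_left) simp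
    also have "?s *\<^sub>R ?z = x + (\<gamma> * \<sigma>) *\<^sub>R q"
      using s by (simp add: scaleR_add_right)
    also have "?s *\<^sub>R (p + (\<gamma> * \<theta> / ?s) *\<^sub>R a) = ?s *\<^sub>R p + (\<gamma> * \<theta>) *\<^sub>R a"
      using s by (simp add: scaleR_add_right)
    also have "x + (\<gamma> * \<sigma>) *\<^sub>R q = ?s *\<^sub>R p + (\<gamma> * \<theta>) *\<^sub>R a
        \<longleftrightarrow> x - p = \<gamma> *\<^sub>R (\<theta> *\<^sub>R a + \<sigma> *\<^sub>R (p - q))"
      by (auto simp: algebra_simps)
    finally show ?thesis .
  qed
  then have "p \<in> resolvent (\<gamma> * \<theta> / ?s) A ?z
      \<longleftrightarrow> (\<exists>a\<in>A p. x - p = \<gamma> *\<^sub>R (\<theta> *\<^sub>R a + \<sigma> *\<^sub>R (p - q)))"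
    unfolding mem_resolvent by simp
  then show ?thesis
    by (auto simp: regularized_resolvent_def p')
qed

text \<open>The summand \<open>\<theta> A\<close> contributes \<open>\<theta> * \<alpha>\<close>,
  the summand \<open>\<sigma> (Id - q)\<close> contributes \<sigma>, and the parameter \<gamma>
  scales both.\<close>

lemma strong_resolvent_regularized_resolvent:
  "strong_resolvent (\<gamma> * (\<theta> * \<alpha> + \<sigma>)) (regularized_resolvent \<gamma> \<theta> \<sigma> q A)"
  unfolding strong_resolvent_def
proof (intro allI)
  fix x y
  let ?J = "regularized_resolvent \<gamma> \<theta> \<sigma> q A"
  define p r where "p = ?J x" and "r = ?J y"
  obtain a b where a: "a \<in> A p" "x - p = \<gamma> *\<^sub>R (\<theta> *\<^sub>R a + \<sigma> *\<^sub>R (p - q))"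
    and b: "b \<in> A r" "y - r = \<gamma> *\<^sub>R (\<theta> *\<^sub>R b + \<sigma> *\<^sub>R (r - q))"
    using regularized_resolvent_eq_iff[of q x p] regularized_resolvent_eq_iff[of q y r]
    unfolding p_def r_def by blast
  have "alpha_monotone \<alpha> A"
    using maximal by (simp add: maximally_alpha_monotone_def)
  from alpha_monotoneD[OF this a(1) b(1)]
  have "\<theta> * (\<alpha> * (norm (p - r))\<^sup>2) \<le> \<theta> * inner (p - r) (a - b)"
    using \<theta> by simp
  then have "\<gamma> * (\<theta> * (\<alpha> * (norm (p - r))\<^sup>2) + \<sigma> * (norm (p - r))\<^sup>2)
      \<le> \<gamma> * (\<theta> * inner (p - r) (a - b) + \<sigma> * (norm (p - r))\<^sup>2)"
    using \<gamma> by simp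
  also have "\<dots> = inner (p - r) ((x - p) - (y - r))"
    unfolding a b by (simp add: power2_norm_eq_inner inner_simps inner_commute algebra_simps)
  finally show "\<gamma> * (\<theta> * \<alpha> + \<sigma>) * (norm (?J x - ?J y))\<^sup>2
      \<le> inner (?J x - ?J y) ((x - ?J x) - (y - ?J y))"
    by (simp add: p_def r_def algebra_simps)
qed

lemma resolvent_eq_singleton:
  assumes "regularized_resolvent \<gamma> \<theta> \<sigma> q A x = p"
  shows "resolvent (\<gamma> * \<theta> / (1 + \<gamma> * \<sigma>)) A
    ((1 / (1 + \<gamma> * \<sigma>)) *\<^sub>R x + (\<gamma> * \<sigma> / (1 + \<gamma> * \<sigma>)) *\<^sub>R q) = {p}"
  using assms singleton unfolding regularized_resolvent_def by (metis is_singleton_the_elem)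

end

section \<open>Reduction of the given iteration to Ryu splitting\<close>

theorem theorem7:
  fixes A B C :: "'a::{real_inner, complete_space} \<Rightarrow> 'a set"
    and \<alpha>A \<alpha>B \<alpha>C \<theta> \<sigma>A \<sigma>B \<sigma>C \<gamma> lam :: real
    and q x0 y0 :: 'a
    and x y u v w :: "nat \<Rightarrow> 'a"
  assumes "maximally_alpha_monotone \<alpha>A A"
    and "maximally_alpha_monotone \<alpha>B B"
    and "maximally_alpha_monotone \<alpha>C C"
    and "\<theta> > 0" and "\<sigma>A > 0" and "\<sigma>B > 0" and "\<sigma>C > 0"
    and "\<theta> * \<alpha>A + \<sigma>A > 0" and "\<theta> * \<alpha>B + \<sigma>B > 0" and "\<theta> * \<alpha>C + \<sigma>C > 0"
    and "\<gamma> > 0"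
    and "0 < lam" and "lam \<le> 1"
    and "q \<in> op_range (id_plus (\<theta> / (\<sigma>A + \<sigma>B + \<sigma>C)) (\<lambda>z. A z + B z + C z))"
    and "x 0 = x0" and "y 0 = y0"
    and "\<And>k. u k = the_elem (resolvent (\<gamma> * \<theta> / (1 + \<gamma> * \<sigma>A)) A
            ((1 / (1 + \<gamma> * \<sigma>A)) *\<^sub>R x k + (\<gamma> * \<sigma>A / (1 + \<gamma> * \<sigma>A)) *\<^sub>R q))"
    and "\<And>k. v k = the_elem (resolvent (\<gamma> * \<theta> / (1 + \<gamma> * \<sigma>B)) B
            ((1 / (1 + \<gamma> * \<sigma>B)) *\<^sub>R (u k + y k) - ((1 - \<gamma> * \<sigma>B) / (1 + \<gamma> * \<sigma>B)) *\<^sub>R q))"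
    and "\<And>k. w k = the_elem (resolvent (\<gamma> * \<theta> / (1 + \<gamma> * \<sigma>C)) C
            ((1 / (1 + \<gamma> * \<sigma>C)) *\<^sub>R (u k - x k + v k - y k) + q))"
    and "\<And>k. x (Suc k) = x k + lam *\<^sub>R (w k - u k)"
    and "\<And>k. y (Suc k) = y k + lam *\<^sub>R (w k - v k)"
  shows "(\<forall>z. is_singleton (resolvent (\<gamma> * \<theta> / (1 + \<gamma> * \<sigma>A)) A z)) \<and>
         (\<forall>z. is_singleton (resolvent (\<gamma> * \<theta> / (1 + \<gamma> * \<sigma>B)) B z)) \<and>
         (\<forall>z. is_singleton (resolvent (\<gamma> * \<theta> / (1 + \<gamma> * \<sigma>C)) C z)) \<and>
         (\<exists>p. resolvent (\<theta> / (\<sigma>A + \<sigma>B + \<sigma>C)) (\<lambda>z. A z + B z + C z) q = {p} \<and>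
              u \<longlonglongrightarrow> p \<and>
              (lam \<noteq> 1 \<longrightarrow>
                (\<exists>xinf. weakly_convergent_to x xinf \<and>
                   resolvent (\<gamma> * \<theta> / (1 + \<gamma> * \<sigma>A)) A
                     ((1 / (1 + \<gamma> * \<sigma>A)) *\<^sub>R xinf + (\<gamma> * \<sigma>A / (1 + \<gamma> * \<sigma>A)) *\<^sub>R q) = {p})))"
proof -
  interpret A: regularized_operator A \<alpha>A \<theta> \<sigma>A \<gamma> by unfold_locales (use assms in auto)
  interpret B: regularized_operator B \<alpha>B \<theta> \<sigma>B \<gamma> by unfold_locales (use assms in auto)
  interpret C: regularized_operator C \<alpha>C \<theta> \<sigma>C \<gamma> by unfold_locales (use assms in auto)
  let ?JA = "regularized_resolvent \<gamma> \<theta> \<sigma>A q A"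
  let ?JB = "regularized_resolvent \<gamma> \<theta> \<sigma>B q B"
  let ?JC = "regularized_resolvent \<gamma> \<theta> \<sigma>C q C"
  let ?T = "ryu_step lam ?JA ?JB ?JC"
  let ?R = "resolvent (\<theta> / (\<sigma>A + \<sigma>B + \<sigma>C)) (\<lambda>z. A z + B z + C z) q"
  note J = A.strong_resolvent_regularized_resolvent[of q] B.strong_resolvent_regularized_resolvent[of q]
    C.strong_resolvent_regularized_resolvent[of q]
  have \<mu>: "0 < \<gamma> * (\<theta> * \<alpha>A + \<sigma>A)" "0 < \<gamma> * (\<theta> * \<alpha>B + \<sigma>B)" "0 < \<gamma> * (\<theta> * \<alpha>C + \<sigma>C)"
    using assms by auto
  note lam = \<open>0 < lam\<close> \<open>lam \<le> 1\<close>
  have fixed: "\<exists>f. ?JA (fst f) = p \<and> ryu_v ?JA ?JB f = p \<and> ryu_w ?JA ?JB ?JC f = p"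
    if p: "p \<in> ?R" for p
  proof -
    let ?\<sigma> = "\<sigma>A + \<sigma>B + \<sigma>C"
    obtain a b c where a: "a \<in> A p" and b: "b \<in> B p" and c: "c \<in> C p"
      and q: "q = p + (\<theta> / ?\<sigma>) *\<^sub>R (a + b + c)"
      using p unfolding mem_resolvent by (auto simp: set_plus_def)
    have "?\<sigma> \<noteq> 0" using assms by simp
    then have "?\<sigma> *\<^sub>R (q - p) = \<theta> *\<^sub>R (a + b + c)"
      unfolding q by simp
    then have "\<gamma> *\<^sub>R (?\<sigma> *\<^sub>R (q - p)) = \<gamma> *\<^sub>R (\<theta> *\<^sub>R (a + b + c))"
      by simp
    then have bal: "\<gamma> *\<^sub>R (\<theta> *\<^sub>R a + \<sigma>A *\<^sub>R (p - q)) + \<gamma> *\<^sub>R (\<theta> *\<^sub>R b + \<sigma>B *\<^sub>R (p - q))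
        + \<gamma> *\<^sub>R (\<theta> *\<^sub>R c + \<sigma>C *\<^sub>R (p - q)) = 0"
      by (simp add: algebra_simps)
    \<comment> \<open>The offset of \<open>fst f\<close> from \<open>p\<close> is the
      \<gamma>-scaled value for \<open>A\<close>, and \<open>snd f\<close> is that for
      \<open>B\<close>. By \<open>bal\<close>, the argument of \<open>?JC\<close> then exceeds
      \<open>p\<close> by the value for \<open>C\<close>.\<close>
    define f where "f = (p + \<gamma> *\<^sub>R (\<theta> *\<^sub>R a + \<sigma>A *\<^sub>R (p - q)), \<gamma> *\<^sub>R (\<theta> *\<^sub>R b + \<sigma>B *\<^sub>R (p - q)))"
    have u: "?JA (fst f) = p"
      unfolding A.regularized_resolvent_eq_iff using a by (auto simp: f_def)
    have v: "ryu_v ?JA ?JB f = p"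
      unfolding ryu_v_def u B.regularized_resolvent_eq_iff using b by (auto simp: f_def)
    have "p - fst f + p - snd f - p = \<gamma> *\<^sub>R (\<theta> *\<^sub>R c + \<sigma>C *\<^sub>R (p - q))"
      using bal unfolding f_def fst_conv snd_conv by (simp add: add_eq_0_iff)
    then have "ryu_w ?JA ?JB ?JC f = p"
      unfolding ryu_w_def u v C.regularized_resolvent_eq_iff using c by blast
    with u v show ?thesis by blast
  qed
  obtain p where p: "p \<in> ?R"
    using \<open>q \<in> op_range _\<close> by (auto simp: resolvent_def op_inverse_def op_range_def)
  obtain f where f: "?JA (fst f) = p" "ryu_v ?JA ?JB f = p" "ryu_w ?JA ?JB ?JC f = p"
    using fixed[OF p] by blast
  \<comment> \<open>Uniqueness is read off the splitting: two resolvent points yield two fixed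
    points of \<open>?T\<close>, whose images under \<open>?JA\<close> agree.\<close>
  have "p' = p" if "p' \<in> ?R" for p'
  proof -
    obtain f' where f': "?JA (fst f') = p'" "ryu_v ?JA ?JB f' = p'" "ryu_w ?JA ?JB ?JC f' = p'"
      using fixed[OF \<open>p' \<in> ?R\<close>] by blast
    have "?T f = f" "?T f' = f'"
      unfolding ryu_step_def f f' by simp_all
    then show ?thesis
      using ryu_fixed_point_unique[OF J \<mu> lam] f f' by blast
  qed
  with p have R: "?R = {p}" by blast
  \<comment> \<open>Shifting \<open>y\<close> by \<open>q\<close> turns the given iteration into \<^const>\<open>ryu_step\<close>.\<close>
  define z where "z k = (x k, y k - q)" for k
  have u: "u k = ?JA (fst (z k))" for k
    by (simp add: z_def assms(17) regularized_resolvent_def)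
  have v: "v k = ryu_v ?JA ?JB (z k)" for k
  proof -
    \<comment> \<open>The coefficient of \<open>q\<close> splits into
      \<open>\<gamma> * \<sigma>B / (1 + \<gamma> * \<sigma>B)\<close> and
      \<open>- 1 / (1 + \<gamma> * \<sigma>B)\<close>; the latter is the shift of
      \<open>y k\<close>.\<close>
    have "(1 / (1 + \<gamma> * \<sigma>B)) *\<^sub>R (u k + y k) - ((1 - \<gamma> * \<sigma>B) / (1 + \<gamma> * \<sigma>B)) *\<^sub>R q
        = (1 / (1 + \<gamma> * \<sigma>B)) *\<^sub>R (u k + (y k - q)) + (\<gamma> * \<sigma>B / (1 + \<gamma> * \<sigma>B)) *\<^sub>R q"
      by (simp add: algebra_simps diff_divide_distrib)
    then show ?thesis
      by (simp add: ryu_v_def u[symmetric]) (simp add: z_def assms(18) regularized_resolvent_def)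
  qed
  have w: "w k = ryu_w ?JA ?JB ?JC (z k)" for k
  proof -
    \<comment> \<open>Here \<open>y k\<close> enters with a minus sign, so its shift adds to the
      averaging weight and the coefficient of \<open>q\<close> becomes 1.\<close>
    have "1 / (1 + \<gamma> * \<sigma>C) + \<gamma> * \<sigma>C / (1 + \<gamma> * \<sigma>C) = 1"
      using C.denominator_pos by (simp add: add_divide_distrib[symmetric])
    then have "q = (1 / (1 + \<gamma> * \<sigma>C)) *\<^sub>R q + (\<gamma> * \<sigma>C / (1 + \<gamma> * \<sigma>C)) *\<^sub>R q"
      by (metis scaleR_add_left scaleR_one)
    then have "(1 / (1 + \<gamma> * \<sigma>C)) *\<^sub>R (u k - x k + v k - y k) + q
        = (1 / (1 + \<gamma> * \<sigma>C)) *\<^sub>R (u k - x k + v k - (y k - q)) + (\<gamma> * \<sigma>C / (1 + \<gamma> * \<sigma>C)) *\<^sub>R q"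
      by (simp add: algebra_simps)
    then show ?thesis
      by (simp add: ryu_w_def u[symmetric] v[symmetric]) (simp add: z_def assms(19) regularized_resolvent_def)
  qed
  have step: "z (Suc k) = ?T (z k)" for k
    unfolding ryu_step_def u[symmetric] v[symmetric] w[symmetric]
    by (simp add: z_def assms(20,21))
  have lim: "u \<longlonglongrightarrow> p"
    using ryu_convergence(1)[where z = z, OF J \<mu> lam f step] unfolding u[symmetric] .
  obtain c where c: "?JA (fst c) = p" and "weakly_convergent_to z c"
    using ryu_convergence(2)[where z = z, OF J \<mu> lam f step] by blast
  from weakly_convergent_to_fst[OF this(2)] have "weakly_convergent_to x (fst c)"
    by (simp add: z_def)
  with A.resolvent_eq_singleton[OF c] R lim A.singleton B.singleton C.singleton
  show ?thesis by blast
qed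

end
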